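(* Let $X$ be a compact metric space with metric $d$ and let $f\in\mathcal C(X)$. Then: (1) $f$ has shadowing if and only if it has FGPOTP. (2) If $f$ has FGPOTP, then it has CGPOTP. (3) If $X$ is perturbable and $f$ has CGPOTP, then $f$ has shadowing and hence FGPOTP.
   Context: $X^X$ is the set of all (not necessarily continuous) functions $X\to X$, with the supremum metric $\rho(f,g)=\sup_{x\in X}d(f(x),g(x))$; $\mathcal C(X)\subseteq X^X$ is the subspace of continuous functions. The notation $\rho(g_0,f|_F)=\sup_{x\in F}d(g_0(x),f(x))$ is used for functions on a subset $F\subseteq X$. $\omega=\{0,1,2,\dots\}$; $h^0$ is the identity for any $h\in X^X$. A metric space $X$ is perturbable if for all $\epsilon>0$ there exists $\delta>0$ such that for every continuous $f:X\to X$, every finite subset $F\subseteq X$, and every function $g_0:F\to X$ with $\rho(g_0,f|_F)<\delta$, there exists a continuous $g:X\to X$ with $\rho(f,g)<\epsilon$ and $g|_F=g_0$. For $\delta>0$, a $\delta$-pseudo-orbit for $f$ is a sequence $\langle x_i\rangle_{i\in\omega}$ in $X$ with $d(f(x_i),x_{i+1})<\delta$ for all $i$. A functionally generated (respectively, continuously generated) $\delta$-pseudo-orbit for $f$ is a sequence $\langle x_i\rangle_{i\in\omega}$ such that there exist $g\in X^X$ (respectively, $g\in\mathcal C(X)$) with $\rho(f,g)<\delta$ and $z\in X$ with $x_i=g^i(z)$ for all $i\in\omega$. $f$ has shadowing (respectively FGPOTP; respectively CGPOTP) if for all $\epsilon>0$ there exists $\delta>0$ such that for every $\delta$-pseudo-orbit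 (respectively, every functionally generated $\delta$-pseudo-orbit; respectively, every continuously generated $\delta$-pseudo-orbit) $\langle x_i\rangle$ for $f$ there exists $z\in X$ with $d(x_i,f^i(z))<\epsilon$ for all $i\in\omega$. *)

theory Defs
  imports "HOL-Analysis.Analysis"
begin

text \<open>
  The metric space is a set \<open>X\<close> in a type of class \<open>metric_space\<close>, with the metric \<open>dist\<close>.
  A function \<open>X \<rightarrow> X\<close> is represented by any \<open>f \<in> X \<rightarrow> X\<close>; its values outside \<open>X\<close> are never used.
\<close>

definition continuous_self_maps :: "'a::metric_space set \<Rightarrow> ('a \<Rightarrow> 'a) set" where
  "continuous_self_maps X = {f \<in> X \<rightarrow> X. continuous_on X f}"

text \<open>
  The supremum is taken in \<open>ennreal\<close>, so that it is \<open>0\<close> over the empty set and \<open>\<infinity>\<close> when the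
  distances are unbounded; the real-valued \<open>Sup\<close> is unspecified in both cases.
\<close>

definition sup_dist :: "'a set \<Rightarrow> ('a \<Rightarrow> 'b::metric_space) \<Rightarrow> ('a \<Rightarrow> 'b) \<Rightarrow> ennreal" where
  "sup_dist A f g = (SUP x\<in>A. ennreal (dist (f x) (g x)))"

definition perturbable :: "'a::metric_space set \<Rightarrow> bool" where
  "perturbable X \<longleftrightarrow>
    (\<forall>\<epsilon>>0. \<exists>\<delta>>0. \<forall>f \<in> continuous_self_maps X. \<forall>F g0.
      finite F \<and> F \<subseteq> X \<and> g0 \<in> F \<rightarrow> X \<and> sup_dist F g0 f < ennreal \<delta> \<longrightarrow>
      (\<exists>g \<in> continuous_self_maps X. sup_dist X f g < ennreal \<epsilon> \<and> (\<forall>x\<in>F. g x = g0 x)))"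

definition pseudo_orbit ::
    "'a::metric_space set \<Rightarrow> ('a \<Rightarrow> 'a) \<Rightarrow> real \<Rightarrow> (nat \<Rightarrow> 'a) \<Rightarrow> bool" where
  "pseudo_orbit X f \<delta> x \<longleftrightarrow> (\<forall>i. x i \<in> X) \<and> (\<forall>i. dist (f (x i)) (x (Suc i)) < \<delta>)"

definition functionally_generated_pseudo_orbit ::
    "'a::metric_space set \<Rightarrow> ('a \<Rightarrow> 'a) \<Rightarrow> real \<Rightarrow> (nat \<Rightarrow> 'a) \<Rightarrow> bool" where
  "functionally_generated_pseudo_orbit X f \<delta> x \<longleftrightarrow>
    (\<exists>g \<in> X \<rightarrow> X. sup_dist X f g < ennreal \<delta> \<and> (\<exists>z\<in>X. \<forall>i. x i = (g ^^ i) z))"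

definition continuously_generated_pseudo_orbit ::
    "'a::metric_space set \<Rightarrow> ('a \<Rightarrow> 'a) \<Rightarrow> real \<Rightarrow> (nat \<Rightarrow> 'a) \<Rightarrow> bool" where
  "continuously_generated_pseudo_orbit X f \<delta> x \<longleftrightarrow>
    (\<exists>g \<in> continuous_self_maps X. sup_dist X f g < ennreal \<delta> \<and> (\<exists>z\<in>X. \<forall>i. x i = (g ^^ i) z))"

definition has_shadowing :: "'a::metric_space set \<Rightarrow> ('a \<Rightarrow> 'a) \<Rightarrow> bool" where
  "has_shadowing X f \<longleftrightarrow>
    (\<forall>\<epsilon>>0. \<exists>\<delta>>0. \<forall>x. pseudo_orbit X f \<delta> x \<longrightarrow>
      (\<exists>z\<in>X. \<forall>i. dist (x i) ((f ^^ i) z) < \<epsilon>))"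

definition has_FGPOTP :: "'a::metric_space set \<Rightarrow> ('a \<Rightarrow> 'a) \<Rightarrow> bool" where
  "has_FGPOTP X f \<longleftrightarrow>
    (\<forall>\<epsilon>>0. \<exists>\<delta>>0. \<forall>x. functionally_generated_pseudo_orbit X f \<delta> x \<longrightarrow>
      (\<exists>z\<in>X. \<forall>i. dist (x i) ((f ^^ i) z) < \<epsilon>))"

definition has_CGPOTP :: "'a::metric_space set \<Rightarrow> ('a \<Rightarrow> 'a) \<Rightarrow> bool" where
  "has_CGPOTP X f \<longleftrightarrow>
    (\<forall>\<epsilon>>0. \<exists>\<delta>>0. \<forall>x. continuously_generated_pseudo_orbit X f \<delta> x \<longrightarrow>
      (\<exists>z\<in>X. \<forall>i. dist (x i) ((f ^^ i) z) < \<epsilon>))"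

end

theory Submission
  imports Defs
begin

text \<open>
  All three notions are compared with one finite condition, \<open>shadows_functional_segments\<close>:
  shadowing of those finite pseudo-orbit segments \<open>x 0, \<dots>, x n\<close> in which equal points have equal
  successors, with an accuracy that does not depend on \<open>n\<close>. Such a segment is the beginning of an
  orbit of a map \<open>g\<close> near \<open>f\<close>: send \<open>x i\<close> to \<open>x (Suc i)\<close> and leave \<open>f\<close> unchanged elsewhere.
  If \<open>X\<close> is perturbable, then \<open>g\<close> can even be chosen continuous. Hence FGPOTP implies the finite
  condition, and so does CGPOTP on a perturbable space. Since every generated pseudo-orbit is a
  pseudo-orbit, it remains to derive shadowing from the finite condition.

  By compactness it suffices to shadow finite segments of a pseudo-orbit \<open>x\<close>
  (\<open>shadow_of_finite_shadows\<close>). Such a segment need not be functional, as a point can recur with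
  different successors. A point with infinitely many points of \<open>X\<close> within a small distance \<open>\<eta>\<close>
  can be moved, so that recurrences at it disappear. The set \<open>P\<close> of the remaining points is finite
  and consists of isolated points. Let \<open>p \<in> P\<close>.

  If \<open>p\<close> is not periodic under \<open>f\<close>, then a sufficiently fine pseudo-orbit visits \<open>p\<close> at most once
  (\<open>isolated_point_on_loop_is_periodic\<close>): a pseudo-orbit loop at \<open>p\<close> contains a loop without
  repetitions, which is functional and therefore shadowed by some \<open>z\<close>; as \<open>p\<close> is isolated, \<open>z = p\<close>,
  and the orbit of \<open>p\<close> closes up.

  If \<open>p\<close> is periodic, then a sufficiently fine pseudo-orbit that visits \<open>p\<close> follows the cycle of
  \<open>p\<close> for ever (\<open>pseudo_orbit_tracks_isolated_cycle\<close>): it stays near the cycle for one period, and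
  is then back at \<open>p\<close> exactly, so that no error accumulates.

  Thus the pseudo-orbit can be replaced by a nearby functional one: up to the first visit to
  a periodic point of \<open>P\<close> its points are made distinct, and from then on the exact cycle is
  followed.
\<close>

section \<open>Functional segments\<close>

definition functional_segment ::
    "'a::metric_space set \<Rightarrow> ('a \<Rightarrow> 'a) \<Rightarrow> real \<Rightarrow> nat \<Rightarrow> (nat \<Rightarrow> 'a) \<Rightarrow> bool" where
  "functional_segment X f \<delta> n x \<longleftrightarrow>
    (\<forall>i\<le>n. x i \<in> X) \<and> (\<forall>i<n. dist (f (x i)) (x (Suc i)) < \<delta>) \<and>
    (\<forall>i<n. \<forall>j<n. x i = x j \<longrightarrow> x (Suc i) = x (Suc j))"

definition shadows_functional_segments :: "'a::metric_space set \<Rightarrow> ('a \<Rightarrow> 'a) \<Rightarrow> bool" where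
  "shadows_functional_segments X f \<longleftrightarrow>
    (\<forall>\<epsilon>>0. \<exists>\<delta>>0. \<forall>n x. functional_segment X f \<delta> n x \<longrightarrow>
      (\<exists>z\<in>X. \<forall>i\<le>n. dist (x i) ((f ^^ i) z) < \<epsilon>))"

lemma functional_segment_successor_map:
  assumes "functional_segment X f \<delta> n x"
  obtains h where "\<And>i. i < n \<Longrightarrow> h (x i) = x (Suc i)"
proof -
  define h where "h y = x (Suc (SOME i. i < n \<and> x i = y))" for y
  have "h (x i) = x (Suc i)" if "i < n" for i
  proof -
    have "(SOME j. j < n \<and> x j = x i) < n \<and> x (SOME j. j < n \<and> x j = x i) = x i"
      by (rule someI [where x = i]) (use that in simp)
    then show ?thesis
      using assms that unfolding h_def functional_segment_def by blast
  qed
  then show thesis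
    using that by blast
qed

lemma funpow_follows_segment:
  assumes "\<And>i. i < n \<Longrightarrow> g (x i) = x (Suc i)" and "i \<le> n"
  shows "(g ^^ i) (x 0) = x i"
  using assms(2) by (induction i) (simp_all add: assms(1))

text \<open>
  A supremum of distances below \<open>\<delta>\<close> can be equal to \<open>\<delta>\<close>, so the strict bounds that pseudo-orbits
  require are obtained by passing from \<open>\<delta> / 2\<close> to \<open>\<delta>\<close>.
\<close>

lemma sup_dist_less:
  assumes "\<delta> > 0" and "\<And>x. x \<in> A \<Longrightarrow> dist (f x) (g x) \<le> \<delta> / 2"
  shows "sup_dist A f g < ennreal \<delta>"
proof -
  have "sup_dist A f g \<le> ennreal (\<delta> / 2)"
    unfolding sup_dist_def by (intro SUP_least ennreal_leI assms(2))
  also have "\<dots> < ennreal \<delta>"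
    using assms(1) by (simp add: ennreal_lessI)
  finally show ?thesis .
qed

lemma dist_less_of_sup_dist:
  assumes "sup_dist A f g < ennreal \<delta>" and "x \<in> A"
  shows "dist (f x) (g x) < \<delta>"
proof -
  have "ennreal (dist (f x) (g x)) \<le> sup_dist A f g"
    unfolding sup_dist_def using assms(2) by (rule SUP_upper)
  then have "ennreal (dist (f x) (g x)) < ennreal \<delta>"
    using assms(1) by (rule le_less_trans)
  then show ?thesis
    by (metis ennreal_less_iff zero_le_dist)
qed

lemma FGPOTP_imp_shadows_functional_segments:
  assumes "f \<in> X \<rightarrow> X" and "has_FGPOTP X f"
  shows "shadows_functional_segments X f"
  unfolding shadows_functional_segments_def
proof (intro allI impI)
  fix \<epsilon> :: real assume "\<epsilon> > 0"
  then obtain \<delta> where "\<delta> > 0"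
    and \<delta>: "\<And>x. functionally_generated_pseudo_orbit X f \<delta> x \<Longrightarrow>
      \<exists>z\<in>X. \<forall>i. dist (x i) ((f ^^ i) z) < \<epsilon>"
    using assms(2) unfolding has_FGPOTP_def by blast
  have "\<exists>z\<in>X. \<forall>i\<le>n. dist (x i) ((f ^^ i) z) < \<epsilon>"
    if seg: "functional_segment X f (\<delta> / 2) n x" for n x
  proof -
    have inX: "x i \<in> X" if "i \<le> n" for i
      using seg that unfolding functional_segment_def by blast
    have step: "dist (f (x i)) (x (Suc i)) \<le> \<delta> / 2" if "i < n" for i
      using seg that unfolding functional_segment_def by (blast intro: less_imp_le)
    obtain h where h: "\<And>i. i < n \<Longrightarrow> h (x i) = x (Suc i)"
      using functional_segment_successor_map [OF seg] by blast
    define g where "g y = (if y \<in> x ` {..<n} then h y else f y)" for y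
    have "g \<in> X \<rightarrow> X"
      using assms(1) by (auto simp: g_def h inX)
    moreover have "sup_dist X f g < ennreal \<delta>"
      using \<open>\<delta> > 0\<close> by (intro sup_dist_less) (auto simp: g_def h step simp del: le_divide_eq_numeral1)
    ultimately have "functionally_generated_pseudo_orbit X f \<delta> (\<lambda>i. (g ^^ i) (x 0))"
      using inX [of 0] unfolding functionally_generated_pseudo_orbit_def by blast
    then obtain z where "z \<in> X" and "\<And>i. dist ((g ^^ i) (x 0)) ((f ^^ i) z) < \<epsilon>"
      using \<delta> by blast
    moreover have "(g ^^ i) (x 0) = x i" if "i \<le> n" for i
      using that by (intro funpow_follows_segment) (auto simp: g_def h)
    ultimately show ?thesis
      by metis
  qed
  then show "\<exists>\<delta>>0. \<forall>n x. functional_segment X f \<delta> n x \<longrightarrow>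
      (\<exists>z\<in>X. \<forall>i\<le>n. dist (x i) ((f ^^ i) z) < \<epsilon>)"
    using \<open>\<delta> > 0\<close> by (intro exI [of _ "\<delta> / 2"]) auto
qed

text \<open>
  Perturbability makes the successor map of a segment extend to a continuous map, because a segment
  has finitely many points. An infinite pseudo-orbit could not be treated directly in this way.
\<close>

lemma perturbable_CGPOTP_imp_shadows_functional_segments:
  assumes "f \<in> continuous_self_maps X" and "perturbable X" and "has_CGPOTP X f"
  shows "shadows_functional_segments X f"
  unfolding shadows_functional_segments_def
proof (intro allI impI)
  fix \<epsilon> :: real assume "\<epsilon> > 0"
  then obtain \<gamma> where "\<gamma> > 0"
    and \<gamma>: "\<And>x. continuously_generated_pseudo_orbit X f \<gamma> x \<Longrightarrow>
      \<exists>z\<in>X. \<forall>i. dist (x i) ((f ^^ i) z) < \<epsilon>"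
    using assms(3) unfolding has_CGPOTP_def by blast
  obtain \<delta> where "\<delta> > 0" and "\<forall>f \<in> continuous_self_maps X. \<forall>F g0.
      finite F \<and> F \<subseteq> X \<and> g0 \<in> F \<rightarrow> X \<and> sup_dist F g0 f < ennreal \<delta> \<longrightarrow>
      (\<exists>g \<in> continuous_self_maps X. sup_dist X f g < ennreal \<gamma> \<and> (\<forall>x\<in>F. g x = g0 x))"
    using assms(2) \<open>\<gamma> > 0\<close> unfolding perturbable_def by metis
  then have \<delta>: "\<exists>g \<in> continuous_self_maps X. sup_dist X f g < ennreal \<gamma> \<and> (\<forall>x\<in>F. g x = g0 x)"
    if "finite F" "F \<subseteq> X" "g0 \<in> F \<rightarrow> X" "sup_dist F g0 f < ennreal \<delta>" for F g0
    using that assms(1) by (simp add: Bex_def)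
  have "\<exists>z\<in>X. \<forall>i\<le>n. dist (x i) ((f ^^ i) z) < \<epsilon>"
    if seg: "functional_segment X f (\<delta> / 2) n x" for n x
  proof -
    have inX: "x i \<in> X" if "i \<le> n" for i
      using seg that unfolding functional_segment_def by blast
    have step: "dist (f (x i)) (x (Suc i)) \<le> \<delta> / 2" if "i < n" for i
      using seg that unfolding functional_segment_def by (blast intro: less_imp_le)
    obtain h where h: "\<And>i. i < n \<Longrightarrow> h (x i) = x (Suc i)"
      using functional_segment_successor_map [OF seg] by blast
    define F where "F = x ` {..<n}"
    have "finite F" "F \<subseteq> X" "h \<in> F \<rightarrow> X"
      by (auto simp: F_def h inX)
    moreover have "sup_dist F h f < ennreal \<delta>"
      using \<open>\<delta> > 0\<close>
      by (intro sup_dist_less) (auto simp: F_def h step dist_commute [of _ "f _"]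
        simp del: le_divide_eq_numeral1)
    ultimately obtain g where g: "g \<in> continuous_self_maps X" "sup_dist X f g < ennreal \<gamma>"
      "\<And>y. y \<in> F \<Longrightarrow> g y = h y"
      using \<delta> [of F h] by blast
    then have "continuously_generated_pseudo_orbit X f \<gamma> (\<lambda>i. (g ^^ i) (x 0))"
      using inX [of 0] unfolding continuously_generated_pseudo_orbit_def by blast
    then obtain z where "z \<in> X" and "\<And>i. dist ((g ^^ i) (x 0)) ((f ^^ i) z) < \<epsilon>"
      using \<gamma> by blast
    moreover have "(g ^^ i) (x 0) = x i" if "i \<le> n" for i
      using that by (intro funpow_follows_segment) (auto simp: g(3) F_def h)
    ultimately show ?thesis
      by metis
  qed
  then show "\<exists>\<delta>>0. \<forall>n x. functional_segment X f \<delta> n x \<longrightarrow>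
      (\<exists>z\<in>X. \<forall>i\<le>n. dist (x i) ((f ^^ i) z) < \<epsilon>)"
    using \<open>\<delta> > 0\<close> by (intro exI [of _ "\<delta> / 2"]) auto
qed

section \<open>Iterates of a continuous self-map\<close>

lemma funpow_in:
  assumes "f \<in> X \<rightarrow> X" and "z \<in> X"
  shows "(f ^^ i) z \<in> X"
  using assms by (induction i) auto

lemma continuous_on_funpow:
  assumes "f \<in> continuous_self_maps X"
  shows "continuous_on X (f ^^ i)"
proof (induction i)
  case 0
  show ?case by (simp add: continuous_on_id)
next
  case (Suc i)
  have "(f ^^ i) ` X \<subseteq> X"
    using assms by (auto simp: continuous_self_maps_def funpow_in)
  then have "continuous_on ((f ^^ i) ` X) f"
    using assms by (auto simp: continuous_self_maps_def intro: continuous_on_subset)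
  with Suc.IH show ?case
    using continuous_on_compose by fastforce
qed

lemma pseudo_orbit_shift:
  assumes "pseudo_orbit X f \<delta> x"
  shows "pseudo_orbit X f \<delta> (\<lambda>i. x (k + i))"
  using assms by (simp add: pseudo_orbit_def)

lemma pseudo_orbit_mono:
  assumes "pseudo_orbit X f \<delta> x" and "\<delta> \<le> \<delta>'"
  shows "pseudo_orbit X f \<delta>' x"
  using assms unfolding pseudo_orbit_def by (meson less_le_trans)

text \<open>
  A limit point of the points that shadow the finite segments shadows the whole sequence. The
  inequality is not strict because it is preserved in the limit.
\<close>

lemma shadow_of_finite_shadows:
  assumes "compact X" and "f \<in> continuous_self_maps X"
    and "\<And>n. \<exists>z\<in>X. \<forall>i\<le>n. dist (x i) ((f ^^ i) z) \<le> \<epsilon>"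
  shows "\<exists>z\<in>X. \<forall>i. dist (x i) ((f ^^ i) z) \<le> \<epsilon>"
proof -
  obtain z where z: "\<And>n. z n \<in> X" "\<And>n i. i \<le> n \<Longrightarrow> dist (x i) ((f ^^ i) (z n)) \<le> \<epsilon>"
    using assms(3) by metis
  obtain l r where l: "l \<in> X" and r: "strict_mono r" and lim: "(z \<circ> r) \<longlonglongrightarrow> l"
    using assms(1) z(1) unfolding compact_def by metis
  have "dist (x i) ((f ^^ i) l) \<le> \<epsilon>" for i
  proof (rule Lim_bounded)
    have "(\<lambda>n. (f ^^ i) (z (r n))) \<longlonglongrightarrow> (f ^^ i) l"
      using continuous_on_tendsto_compose [OF continuous_on_funpow [OF assms(2)] lim l] z(1)
      by simp
    then show "(\<lambda>n. dist (x i) ((f ^^ i) (z (r n)))) \<longlonglongrightarrow> dist (x i) ((f ^^ i) l)"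
      by (intro tendsto_intros)
    show "\<forall>n\<ge>i. dist (x i) ((f ^^ i) (z (r n))) \<le> \<epsilon>"
      using z(2) seq_suble [OF r] order_trans by blast
  qed
  with l show ?thesis
    by blast
qed

lemma pseudo_orbit_tracks_finite_time:
  assumes "compact X" and "f \<in> continuous_self_maps X" and "\<epsilon> > 0"
  shows "\<exists>\<delta>>0. \<forall>x. pseudo_orbit X f \<delta> x \<longrightarrow> (\<forall>i\<le>n. dist (x i) ((f ^^ i) (x 0)) < \<epsilon>)"
  using assms(3)
proof (induction n arbitrary: \<epsilon>)
  case 0
  then show ?case by (auto intro: exI [of _ 1])
next
  case (Suc n)
  have f: "f \<in> X \<rightarrow> X" and "uniformly_continuous_on X f"
    using assms(1,2) by (auto simp: continuous_self_maps_def compact_uniformly_continuous)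
  moreover have "\<epsilon> / 2 > 0"
    using Suc.prems by simp
  ultimately obtain \<eta> where "\<eta> > 0"
    and \<eta>: "\<And>u v. u \<in> X \<Longrightarrow> v \<in> X \<Longrightarrow> dist u v < \<eta> \<Longrightarrow> dist (f u) (f v) < \<epsilon> / 2"
    unfolding uniformly_continuous_on_def by metis
  then obtain \<delta> where "\<delta> > 0"
    and \<delta>: "\<And>x i. pseudo_orbit X f \<delta> x \<Longrightarrow> i \<le> n \<Longrightarrow> dist (x i) ((f ^^ i) (x 0)) < min \<eta> \<epsilon>"
    using Suc.IH [of "min \<eta> \<epsilon>"] Suc.prems by auto
  have "dist (x i) ((f ^^ i) (x 0)) < \<epsilon>"
    if x: "pseudo_orbit X f (min \<delta> (\<epsilon> / 2)) x" and "i \<le> Suc n" for x i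
  proof -
    have track: "dist (x j) ((f ^^ j) (x 0)) < min \<eta> \<epsilon>" if "j \<le> n" for j
      using \<delta> [OF pseudo_orbit_mono [OF x] that] by simp
    have "dist (f (x n)) (f ((f ^^ n) (x 0))) < \<epsilon> / 2"
      using track [of n] x f by (intro \<eta> funpow_in) (auto simp: pseudo_orbit_def)
    moreover have "dist (f (x n)) (x (Suc n)) < \<epsilon> / 2"
      using x by (simp add: pseudo_orbit_def)
    ultimately have "dist (x (Suc n)) ((f ^^ Suc n) (x 0)) < \<epsilon>"
      by (simp add: dist_triangle_half_r)
    with track that(2) show ?thesis
      by (auto simp: le_Suc_eq)
  qed
  then show ?case
    using \<open>\<delta> > 0\<close> Suc.prems by (intro exI [of _ "min \<delta> (\<epsilon> / 2)"]) auto
qed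

section \<open>Pseudo-orbits through isolated points\<close>

text \<open>
  The pseudo-orbit is compared with the cycle over one period only. At the end of a period it
  is so close to the isolated point \<open>p\<close> that it is equal to \<open>p\<close>, and the comparison starts afresh.
\<close>

lemma pseudo_orbit_tracks_isolated_cycle:
  assumes "compact X" and "f \<in> continuous_self_maps X" and "\<epsilon> > 0"
    and isolated: "r > 0" "X \<inter> ball p r \<subseteq> {p}" and periodic: "N > 0" "(f ^^ N) p = p"
  shows "\<exists>\<delta>>0. \<forall>x. pseudo_orbit X f \<delta> x \<and> x 0 = p \<longrightarrow> (\<forall>i. dist (x i) ((f ^^ i) p) < \<epsilon>)"
proof -
  obtain \<delta> where "\<delta> > 0"
    and \<delta>: "\<And>x i. pseudo_orbit X f \<delta> x \<Longrightarrow> i \<le> N \<Longrightarrow> dist (x i) ((f ^^ i) (x 0)) < min \<epsilon> r"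
    using pseudo_orbit_tracks_finite_time [OF assms(1,2), of "min \<epsilon> r" N] assms(3) isolated(1)
    by auto
  have "dist (x i) ((f ^^ i) p) < \<epsilon>" if x: "pseudo_orbit X f \<delta> x" "x 0 = p" for x i
    using x
  proof (induction i arbitrary: x rule: less_induct)
    case (less i)
    show ?case
    proof (cases "i \<le> N")
      case True
      then show ?thesis
        using \<delta> [OF less.prems(1), of i] less.prems(2) by simp
    next
      case False
      have "dist (x N) p < r"
        using \<delta> [OF less.prems(1), of N] less.prems(2) periodic(2) by simp
      then have "x N = p"
        using isolated(2) less.prems(1) by (auto simp: pseudo_orbit_def dist_commute)
      then have "dist (x (N + (i - N))) ((f ^^ (i - N)) p) < \<epsilon>"
        using less.IH [of "i - N" "\<lambda>k. x (N + k)"] pseudo_orbit_shift [OF less.prems(1)]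
          False periodic(1) by simp
      moreover have "(f ^^ i) p = (f ^^ (i - N)) ((f ^^ N) p)"
        using False by (metis comp_apply funpow_add le_add_diff_inverse2 nat_le_linear)
      ultimately show ?thesis
        using False periodic(2) by simp
    qed
  qed
  with \<open>\<delta> > 0\<close> show ?thesis
    by blast
qed

text \<open>
  A shortest loop at \<open>p\<close> has no repetitions, since the part between two equal points can be cut
  out. Hence it is a functional segment. A point that shadows it with an accuracy below the
  isolation radius of \<open>p\<close> must be \<open>p\<close> itself, and it must return to \<open>p\<close>.
\<close>

lemma isolated_point_on_loop_is_periodic:
  assumes "shadows_functional_segments X f" and "p \<in> X"
    and isolated: "r > 0" "X \<inter> ball p r \<subseteq> {p}" and f: "f \<in> X \<rightarrow> X"
  shows "\<exists>\<delta>>0. \<forall>x i j. pseudo_orbit X f \<delta> x \<and> i < j \<and> x i = p \<and> x j = p \<longrightarrow>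
    (\<exists>N>0. (f ^^ N) p = p)"
proof -
  obtain \<delta> where "\<delta> > 0"
    and \<delta>: "\<And>n x. functional_segment X f \<delta> n x \<Longrightarrow> \<exists>z\<in>X. \<forall>i\<le>n. dist (x i) ((f ^^ i) z) < r"
    using assms(1) isolated(1) unfolding shadows_functional_segments_def by metis
  have loop: "\<exists>N>0. (f ^^ N) p = p"
    if "k > 0" "x 0 = p" "x k = p" "\<forall>i\<le>k. x i \<in> X" "\<forall>i<k. dist (f (x i)) (x (Suc i)) < \<delta>" for k x
    using that
  proof (induction k arbitrary: x rule: less_induct)
    case (less k)
    show ?case
    proof (cases "inj_on x {..<k}")
      case True
      then have "functional_segment X f \<delta> k x"
        using less.prems(4,5) by (auto simp: functional_segment_def inj_on_def)
      then obtain z where z: "z \<in> X" "\<And>i. i \<le> k \<Longrightarrow> dist (x i) ((f ^^ i) z) < r"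
        using \<delta> by blast
      have "z = p"
        using z(1) z(2) [of 0] isolated(2) less.prems(2) by auto
      moreover have "(f ^^ k) z \<in> X \<inter> ball p r"
        using z(2) [of k] less.prems(3) funpow_in [OF f z(1)] by simp
      ultimately show ?thesis
        using isolated(2) less.prems(1) by blast
    next
      case False
      then obtain i j where ij: "i < j" "j < k" "x i = x j"
        unfolding inj_on_def by (metis lessThan_iff linorder_neqE_nat)
      define y where "y l = (if l \<le> i then x l else x (l + (j - i)))" for l
      \<comment> \<open>The jump of \<open>y\<close> from \<open>i\<close> to \<open>Suc i\<close> is a step of \<open>x\<close> from \<open>j\<close>, because \<open>x i = x j\<close>.\<close>
      have "dist (f (y l)) (y (Suc l)) < \<delta>" if "l < k - (j - i)" for l
      proof -
        consider "l < i" | "l = i" | "l > i" by linarith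
        then show ?thesis
        proof cases
          case 1
          then show ?thesis using less.prems(5) ij by (simp add: y_def)
        next
          case 2
          then show ?thesis using less.prems(5) ij by (simp add: y_def)
        next
          case 3
          then show ?thesis using less.prems(5) ij that by (simp add: y_def)
        qed
      qed
      moreover have "\<forall>l\<le>k - (j - i). y l \<in> X"
        using less.prems(4) ij by (auto simp: y_def)
      moreover have "y 0 = p" "y (k - (j - i)) = p"
        using less.prems(2,3) ij by (auto simp: y_def)
      moreover have "0 < k - (j - i)" "k - (j - i) < k"
        using ij by auto
      ultimately show ?thesis
        using less.IH by blast
    qed
  qed
  have "\<exists>N>0. (f ^^ N) p = p" if "pseudo_orbit X f \<delta> x" "i < j" "x i = p" "x j = p" for x i j
    using that by (intro loop [of "j - i" "\<lambda>l. x (i + l)"]) (auto simp: pseudo_orbit_def)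
  with \<open>\<delta> > 0\<close> show ?thesis
    by blast
qed

section \<open>Making pseudo-orbits functional\<close>

text \<open>
  Otherwise these points accumulate at some \<open>c\<close>; one of them that is close to \<open>c\<close> has infinitely
  many of the others in its ball.
\<close>

lemma finite_locally_finite_points:
  fixes X :: "'a::metric_space set"
  assumes "compact X" and "\<eta> > 0"
  shows "finite {p \<in> X. finite (X \<inter> ball p \<eta>)}" (is "finite ?P")
proof (rule ccontr)
  assume "infinite ?P"
  then obtain c where "c islimpt ?P"
    using assms(1) unfolding compact_eq_Bolzano_Weierstrass by blast
  then have inf: "infinite (?P \<inter> ball c (\<eta> / 2))"
    using assms(2) unfolding islimpt_eq_infinite_ball by simp
  then obtain p where p: "p \<in> ?P" "p \<in> ball c (\<eta> / 2)"
    using infinite_imp_nonempty [OF inf] by blast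
  have "?P \<inter> ball c (\<eta> / 2) \<subseteq> X \<inter> ball p \<eta>"
    using p(2) by (auto intro: dist_triangle_half_r [of c] simp del: less_divide_eq_numeral1)
  with inf p(1) show False
    using finite_subset by blast
qed

lemma isolated_of_finite_ball:
  fixes X :: "'a::metric_space set"
  assumes "finite (X \<inter> ball p \<eta>)" and "\<eta> > 0"
  obtains r where "r > 0" "X \<inter> ball p r \<subseteq> {p}"
proof -
  obtain d where "d > 0" and d: "\<And>x. x \<in> X \<inter> ball p \<eta> \<Longrightarrow> x \<noteq> p \<Longrightarrow> d \<le> dist p x"
    using finite_set_avoid [OF assms(1), of p] by blast
  have "X \<inter> ball p (min d \<eta>) \<subseteq> {p}"
    using d by force
  then show thesis
    using that [of "min d \<eta>"] \<open>d > 0\<close> assms(2) by simp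
qed

lemma distinct_representatives_of_infinite_sets:
  assumes "finite I" and "\<And>i. i \<in> I \<Longrightarrow> infinite (A i)" and "finite B"
  shows "\<exists>y. (\<forall>i\<in>I. y i \<in> A i - B) \<and> inj_on y I"
  using assms(1,2)
proof (induction I rule: finite_induct)
  case empty
  show ?case by simp
next
  case (insert i I)
  then obtain y where y: "\<forall>i\<in>I. y i \<in> A i - B" "inj_on y I"
    by auto
  have "infinite (A i - (B \<union> y ` I))"
    using insert assms(3) by (intro Diff_infinite_finite) auto
  then obtain a where "a \<in> A i - (B \<union> y ` I)"
    by (metis ex_in_conv finite.emptyI)
  with y insert.hyps show ?case
    by (intro exI [of _ "y(i := a)"]) (auto simp: inj_on_def)
qed

text \<open>
  The points outside \<open>P\<close> can be moved, and they have to avoid \<open>P\<close>, whose points stay in place. The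
  set \<open>C\<close> is kept free for the cycle that the pseudo-orbit is going to enter.
\<close>

lemma make_distinct:
  fixes x :: "nat \<Rightarrow> 'a::metric_space"
  assumes "finite P" and "\<And>q. q \<in> X - P \<Longrightarrow> infinite (X \<inter> ball q \<eta>)" and "\<eta> > 0"
    and "finite C" and "\<And>i. x i \<in> X"
    and once: "\<And>i j. i < m \<Longrightarrow> j < m \<Longrightarrow> x i \<in> P \<Longrightarrow> x i = x j \<Longrightarrow> i = j"
    and fresh: "\<And>i. i < m \<Longrightarrow> x i \<in> P \<Longrightarrow> x i \<notin> C"
  obtains y where "inj_on y {..<m}"
    and "\<And>i. i < m \<Longrightarrow> y i \<in> X \<and> dist (x i) (y i) < \<eta> \<and> y i \<notin> C"
proof -
  define I where "I = {i. i < m \<and> x i \<notin> P}"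
  have "\<exists>w. (\<forall>i\<in>I. w i \<in> (X \<inter> ball (x i) \<eta>) - (P \<union> C)) \<and> inj_on w I"
    by (rule distinct_representatives_of_infinite_sets) (use assms(1,2,4,5) in \<open>auto simp: I_def\<close>)
  then obtain w where w: "\<And>i. i \<in> I \<Longrightarrow> w i \<in> (X \<inter> ball (x i) \<eta>) - (P \<union> C)" "inj_on w I"
    by blast
  define y where "y i = (if x i \<in> P then x i else w i)" for i
  have "inj_on y {..<m}"
  proof (rule inj_onI)
    fix i j assume "i \<in> {..<m}" "j \<in> {..<m}" and eq: "y i = y j"
    then have m: "i < m" "j < m"
      by auto
    have notin: "w k \<notin> P" if "k < m" "x k \<notin> P" for k
      using w(1) [of k] that by (simp add: I_def)
    show "i = j"
    proof (cases "x i \<in> P")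
      case True
      then have "x j \<in> P"
        using eq notin m by (metis y_def)
      with True eq once m show ?thesis
        by (simp add: y_def)
    next
      case False
      then have "x j \<notin> P"
        using eq notin m by (metis y_def)
      with False eq m w(2) show ?thesis
        by (simp add: y_def I_def inj_on_def)
    qed
  qed
  moreover have "y i \<in> X \<and> dist (x i) (y i) < \<eta> \<and> y i \<notin> C" if "i < m" for i
    using w(1) [of i] that assms(3,5) fresh by (auto simp: y_def I_def)
  ultimately show thesis
    using that by blast
qed

text \<open>
  The constants are chosen in the order \<open>\<delta>\<close>, \<open>\<eta>\<close>, \<open>P\<close>, \<open>\<delta>'\<close>: the finite condition yields the
  accuracy \<open>\<delta>\<close> that the modified segment must have, \<open>\<eta>\<close> bounds how far points can be moved, and
  \<open>\<eta>\<close> determines \<open>P\<close>. How fine a pseudo-orbit must be in order to visit a point of \<open>P\<close> only once,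
  or to follow its cycle, depends on that point; the finiteness of \<open>P\<close> gives a common \<open>\<delta>'\<close>.
\<close>

lemma shadows_functional_segments_imp_shadowing:
  fixes X :: "'a::metric_space set"
  assumes X: "compact X" and f: "f \<in> continuous_self_maps X"
    and short: "shadows_functional_segments X f"
  shows "has_shadowing X f"
  unfolding has_shadowing_def
proof (intro allI impI)
  fix \<epsilon> :: real assume "\<epsilon> > 0"
  have self: "f \<in> X \<rightarrow> X" and unif: "uniformly_continuous_on X f"
    using X f by (auto simp: continuous_self_maps_def compact_uniformly_continuous)
  have "\<epsilon> / 3 > 0"
    using \<open>\<epsilon> > 0\<close> by simp
  then obtain \<delta> where "\<delta> > 0"
    and \<delta>: "\<And>n y. functional_segment X f \<delta> n y \<Longrightarrow>
      \<exists>z\<in>X. \<forall>i\<le>n. dist (y i) ((f ^^ i) z) < \<epsilon> / 3"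
    using short unfolding shadows_functional_segments_def by metis
  then have "\<delta> / 3 > 0"
    by simp
  then obtain \<eta>0 where "\<eta>0 > 0"
    and \<eta>0: "\<And>u v. u \<in> X \<Longrightarrow> v \<in> X \<Longrightarrow> dist u v < \<eta>0 \<Longrightarrow> dist (f u) (f v) < \<delta> / 3"
    using unif unfolding uniformly_continuous_on_def by metis
  define \<eta> where "\<eta> = Min {\<eta>0, \<delta> / 3, \<epsilon> / 3}"
  have \<eta>: "\<eta> > 0" "\<eta> \<le> \<eta>0" "\<eta> \<le> \<delta> / 3" "\<eta> \<le> \<epsilon> / 3"
    using \<open>\<eta>0 > 0\<close> \<open>\<delta> > 0\<close> \<open>\<epsilon> > 0\<close> by (auto simp: \<eta>_def)
  define P where "P = {p \<in> X. finite (X \<inter> ball p \<eta>)}"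
  have "finite P"
    unfolding P_def by (rule finite_locally_finite_points [OF X \<eta>(1)])
  define per where "per p \<longleftrightarrow> (\<exists>N>0. (f ^^ N) p = p)" for p
  have "\<forall>p\<in>P. \<exists>d>0. \<forall>x. pseudo_orbit X f d x \<longrightarrow>
      (per p \<longrightarrow> x 0 = p \<longrightarrow> (\<forall>i. dist (x i) ((f ^^ i) p) < \<eta>)) \<and>
      (\<not> per p \<longrightarrow> (\<forall>i j. x i = p \<longrightarrow> x j = p \<longrightarrow> i = j))"
  proof
    fix p assume "p \<in> P"
    then obtain r where r: "r > 0" "X \<inter> ball p r \<subseteq> {p}"
      using isolated_of_finite_ball \<eta>(1) unfolding P_def by blast
    show "\<exists>d>0. \<forall>x. pseudo_orbit X f d x \<longrightarrow>
      (per p \<longrightarrow> x 0 = p \<longrightarrow> (\<forall>i. dist (x i) ((f ^^ i) p) < \<eta>)) \<and>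
      (\<not> per p \<longrightarrow> (\<forall>i j. x i = p \<longrightarrow> x j = p \<longrightarrow> i = j))"
    proof (cases "per p")
      case True
      then obtain N where "N > 0" "(f ^^ N) p = p"
        by (auto simp: per_def)
      then obtain d where "d > 0"
        and "\<forall>x. pseudo_orbit X f d x \<and> x 0 = p \<longrightarrow> (\<forall>i. dist (x i) ((f ^^ i) p) < \<eta>)"
        using pseudo_orbit_tracks_isolated_cycle [OF X f \<eta>(1) r] by blast
      with True show ?thesis
        by (intro exI [of _ d]) simp
    next
      case False
      have "p \<in> X"
        using \<open>p \<in> P\<close> by (simp add: P_def)
      obtain d where "d > 0"
        and d: "\<forall>x i j. pseudo_orbit X f d x \<and> i < j \<and> x i = p \<and> x j = p \<longrightarrow> per p"
        using isolated_point_on_loop_is_periodic [OF short \<open>p \<in> X\<close> r self, folded per_def] by blast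
      have "i = j" if "pseudo_orbit X f d x" "x i = p" "x j = p" for x i j
      proof (rule ccontr)
        assume "i \<noteq> j"
        then consider "i < j" | "j < i"
          by linarith
        then show False
          using d [rule_format, of x] that False by cases auto
      qed
      with \<open>d > 0\<close> False show ?thesis
        by (intro exI [of _ d]) simp
    qed
  qed
  then obtain d where d: "\<forall>p\<in>P. d p > 0 \<and> (\<forall>x. pseudo_orbit X f (d p) x \<longrightarrow>
      (per p \<longrightarrow> x 0 = p \<longrightarrow> (\<forall>i. dist (x i) ((f ^^ i) p) < \<eta>)) \<and>
      (\<not> per p \<longrightarrow> (\<forall>i j. x i = p \<longrightarrow> x j = p \<longrightarrow> i = j)))"
    by (rule bchoice [THEN exE])
  have cycle: "dist (x i) ((f ^^ i) p) < \<eta>"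
    if "p \<in> P" "pseudo_orbit X f (d p) x" "per p" "x 0 = p" for p x i
    using d that by simp
  have once: "i = j"
    if "p \<in> P" "pseudo_orbit X f (d p) x" "\<not> per p" "x i = p" "x j = p" for p x i j
    using d [rule_format, OF that(1)] that by simp
  define \<delta>' where "\<delta>' = Min (insert (\<delta> / 3) (d ` P))"
  have \<delta>': "\<delta>' > 0" "\<delta>' \<le> \<delta> / 3" "\<And>p. p \<in> P \<Longrightarrow> \<delta>' \<le> d p"
    unfolding \<delta>'_def using \<open>finite P\<close> \<open>\<delta> > 0\<close> d by (simp, intro Min_le, simp_all)
  have "\<exists>z\<in>X. \<forall>i. dist (x i) ((f ^^ i) z) < \<epsilon>" if x: "pseudo_orbit X f \<delta>' x" for x
  proof -
    have xX: "x i \<in> X" and step: "dist (f (x i)) (x (Suc i)) < \<delta> / 3" for i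
      using pseudo_orbit_mono [OF x \<delta>'(2)] by (simp_all add: pseudo_orbit_def)
    have movable: "infinite (X \<inter> ball q \<eta>)" if "q \<in> X - P" for q
      using that by (simp add: P_def)
    have visit_once: "i = j" if "x i \<in> P" "\<not> per (x i)" "x i = x j" for i j
      using once [OF that(1) pseudo_orbit_mono [OF x \<delta>'(3) [OF that(1)]] that(2)] that(3) by simp
    have functional: "\<exists>y. (\<forall>i\<le>n. y i \<in> X \<and> dist (x i) (y i) < \<eta>) \<and>
        (\<forall>i<n. \<forall>j<n. y i = y j \<longrightarrow> y (Suc i) = y (Suc j))" for n
    proof (cases "\<exists>t. x t \<in> P \<and> per (x t)")
      case False
      obtain y where inj: "inj_on y {..<Suc n}"
        and y: "\<And>i. i < Suc n \<Longrightarrow> y i \<in> X \<and> dist (x i) (y i) < \<eta> \<and> y i \<notin> {}"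
      proof (rule make_distinct [OF \<open>finite P\<close> movable \<eta>(1) finite.emptyI xX, of "Suc n"])
        show "i = j" if "x i \<in> P" "x i = x j" for i j
          using False visit_once that by blast
      qed auto
      have "i = j" if "i < n" "j < n" "y i = y j" for i j
        using inj_onD [OF inj that(3)] that(1,2) by simp
      with y show ?thesis
        by (metis less_Suc_eq_le)
    next
      case True
      define t where "t = (LEAST t. x t \<in> P \<and> per (x t))"
      have t: "x t \<in> P" "per (x t)"
        using LeastI_ex [OF True] by (auto simp: t_def)
      have before: "\<not> per (x i)" if "i < t" "x i \<in> P" for i
        using not_less_Least [of i] that unfolding t_def by blast
      define c where "c k = (f ^^ k) (x t)" for k
      obtain N where N: "N > 0" "c N = x t"
        using t(2) by (auto simp: per_def c_def)
      have c_add: "c (i + j) = (f ^^ i) (c j)" for i j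
        by (simp add: c_def funpow_add)
      have c_per: "(f ^^ N) (c k) = c k" for k
        using N(2) by (metis add.commute c_add c_def)
      have c_mod: "c (k mod N) = c k" for k
        using N(2) by (simp add: c_def funpow_mod_eq)
      have "range c \<subseteq> c ` {..<N}"
      proof clarify
        fix k
        have "k mod N < N"
          using N(1) by simp
        then show "c k \<in> c ` {..<N}"
          using c_mod [of k] by (metis imageI lessThan_iff)
      qed
      then have "finite (range c)"
        using finite_subset by blast
      \<comment> \<open>Every point of the cycle is periodic, so the points of \<open>P\<close> visited before \<open>t\<close> are not on it.\<close>
      have "per (c k)" for k
        unfolding per_def using N(1) c_per by blast
      then have off_cycle: "x i \<notin> range c" if "i < t" "x i \<in> P" for i
        using before [OF that] by force
      obtain w where inj: "inj_on w {..<t}"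
        and w: "\<And>i. i < t \<Longrightarrow> w i \<in> X \<and> dist (x i) (w i) < \<eta> \<and> w i \<notin> range c"
      proof (rule make_distinct [OF \<open>finite P\<close> movable \<eta>(1) \<open>finite (range c)\<close> xX, of t])
        show "i = j" if "i < t" "x i \<in> P" "x i = x j" for i j
          by (rule visit_once [OF that(2) before [OF that(1,2)] that(3)])
      qed (use off_cycle in auto)
      \<comment> \<open>Since \<open>w\<close> avoids the cycle, no point before \<open>t\<close> recurs on the tail.\<close>
      define y where "y i = (if i < t then w i else c (i - t))" for i
      have near: "dist (x (t + k)) (c k) < \<eta>" for k
        using cycle [OF t(1) pseudo_orbit_shift [OF pseudo_orbit_mono [OF x \<delta>'(3) [OF t(1)]]] t(2)]
        by (simp add: c_def)
      have "c k \<in> X" for k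
        unfolding c_def by (rule funpow_in [OF self xX])
      moreover have "dist (x i) (c (i - t)) < \<eta>" if "\<not> i < t" for i
        using near [of "i - t"] that by simp
      ultimately have "\<forall>i. y i \<in> X \<and> dist (x i) (y i) < \<eta>"
        using w by (simp add: y_def)
      moreover have "y (Suc i) = y (Suc j)" if eq: "y i = y j" for i j
      proof (cases "i < t")
        case True
        then have "j < t"
          using eq w by (metis rangeI y_def)
        with True eq have "i = j"
          by (intro inj_onD [OF inj]) (simp_all add: y_def)
        then show ?thesis
          by simp
      next
        case False
        then have "\<not> j < t"
          using eq w by (metis rangeI y_def)
        with False eq show ?thesis
          by (simp add: y_def Suc_diff_le c_def)
      qed
      ultimately show ?thesis
        by blast
    qed
    have "\<exists>z\<in>X. \<forall>i\<le>n. dist (x i) ((f ^^ i) z) \<le> 2 * \<epsilon> / 3" for n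
    proof -
      obtain y where y: "\<And>i. i \<le> n \<Longrightarrow> y i \<in> X" "\<And>i. i \<le> n \<Longrightarrow> dist (x i) (y i) < \<eta>"
        and func: "\<forall>i<n. \<forall>j<n. y i = y j \<longrightarrow> y (Suc i) = y (Suc j)"
        using functional [of n] by blast
      have "dist (f (y i)) (y (Suc i)) < \<delta>" if "i < n" for i
      proof -
        have "dist (f (x i)) (f (y i)) < \<delta> / 3"
          using y [of i] that \<eta>(2) xX by (intro \<eta>0) auto
        moreover have "dist (x (Suc i)) (y (Suc i)) < \<delta> / 3"
          using y(2) [of "Suc i"] that \<eta>(3) by simp
        \<comment> \<open>Moving \<open>y i\<close> to \<open>x i\<close>, the step of \<open>x\<close> and moving back cost less than \<open>\<delta> / 3\<close> each.\<close>
        ultimately show ?thesis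
          using step [of i] dist_triangle [of "f (y i)" "y (Suc i)" "f (x i)"]
            dist_triangle [of "f (x i)" "y (Suc i)" "x (Suc i)"] by (simp add: dist_commute)
      qed
      then have "functional_segment X f \<delta> n y"
        using y(1) func unfolding functional_segment_def by blast
      then obtain z where "z \<in> X" and z: "\<And>i. i \<le> n \<Longrightarrow> dist (y i) ((f ^^ i) z) < \<epsilon> / 3"
        using \<delta> by blast
      have "dist (x i) ((f ^^ i) z) \<le> 2 * \<epsilon> / 3" if "i \<le> n" for i
        using y(2) [OF that] z [OF that] \<eta>(4) dist_triangle [of "x i" "(f ^^ i) z" "y i"] by simp
      with \<open>z \<in> X\<close> show ?thesis
        by blast
    qed
    then obtain z where "z \<in> X" and z: "\<And>i. dist (x i) ((f ^^ i) z) \<le> 2 * \<epsilon> / 3"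
      using shadow_of_finite_shadows [OF X f] by blast
    have "dist (x i) ((f ^^ i) z) < \<epsilon>" for i
      using z [of i] \<open>\<epsilon> > 0\<close> by simp
    with \<open>z \<in> X\<close> show ?thesis
      by blast
  qed
  with \<delta>'(1) show "\<exists>\<delta>>0. \<forall>x. pseudo_orbit X f \<delta> x \<longrightarrow>
      (\<exists>z\<in>X. \<forall>i. dist (x i) ((f ^^ i) z) < \<epsilon>)"
    by blast
qed

section \<open>Comparison of the shadowing properties\<close>

lemma functionally_generated_imp_pseudo_orbit:
  assumes "functionally_generated_pseudo_orbit X f \<delta> x"
  shows "pseudo_orbit X f \<delta> x"
proof -
  obtain g z where g: "g \<in> X \<rightarrow> X" "sup_dist X f g < ennreal \<delta>"
    and "z \<in> X" and x: "\<And>i. x i = (g ^^ i) z"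
    using assms unfolding functionally_generated_pseudo_orbit_def by blast
  then have "x i \<in> X" for i
    by (simp add: funpow_in)
  with g(2) show ?thesis
    by (auto simp: pseudo_orbit_def x dest: dist_less_of_sup_dist)
qed

lemma continuously_generated_imp_functionally_generated:
  assumes "continuously_generated_pseudo_orbit X f \<delta> x"
  shows "functionally_generated_pseudo_orbit X f \<delta> x"
  using assms
  unfolding continuously_generated_pseudo_orbit_def functionally_generated_pseudo_orbit_def
    continuous_self_maps_def by blast

theorem corollary26:
  fixes X :: "'a::metric_space set" and f :: "'a \<Rightarrow> 'a"
  assumes "compact X"
    and "f \<in> continuous_self_maps X"
  shows "(has_shadowing X f \<longleftrightarrow> has_FGPOTP X f)
    \<and> (has_FGPOTP X f \<longrightarrow> has_CGPOTP X f)
    \<and> (perturbable X \<and> has_CGPOTP X f \<longrightarrow> has_shadowing X f \<and> has_FGPOTP X f)"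
proof -
  have self: "f \<in> X \<rightarrow> X"
    using assms(2) by (simp add: continuous_self_maps_def)
  have 1: "has_FGPOTP X f" if "has_shadowing X f"
    using that functionally_generated_imp_pseudo_orbit
    unfolding has_shadowing_def has_FGPOTP_def by metis
  have 2: "has_CGPOTP X f" if "has_FGPOTP X f"
    using that continuously_generated_imp_functionally_generated
    unfolding has_FGPOTP_def has_CGPOTP_def by metis
  have 3: "has_shadowing X f" if "has_FGPOTP X f"
    using that assms self FGPOTP_imp_shadows_functional_segments
      shadows_functional_segments_imp_shadowing by blast
  have 4: "has_shadowing X f" if "perturbable X" "has_CGPOTP X f"
    using that assms perturbable_CGPOTP_imp_shadows_functional_segments
      shadows_functional_segments_imp_shadowing by blast
  from 1 2 3 4 show ?thesis
    by blast
qed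

end
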